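(* Let $f^0(x,y)$ be a curvature surface on $D=\{(x,y)\in\mathbb{R}^2:x>0\}$. Then for every $x\in(0,\infty)$ $$\lim_{y\to\infty}f^0(x,y)=\lim_{y\to-\infty}f^0(x,y).$$
   Context: $X_0(x)=\frac52+\sum_{k\ge1}a_kx^{2k}$ (analytic on $\mathbb{R}$), $a_1=1$, $2(k+1)(4k^2+\frac54)a_{k+1}+(2k-1)a_k=0$ $(k\ge1)$. $h(x,y)=2X_0-xX_0'+y^2\frac{X_0'}{x}+\sqrt5$ (positive). On $D$ put $a_1=\frac{2y}{xh}(X_0+\frac{\sqrt5}{2})$, $b_1=-\frac{1}{xh}(X_0+\frac{\sqrt5}{2}+\sqrt5(x^2-y^2))$, $c_1=-\frac{2}{xh}(X_0+\frac{\sqrt5}{2})$, $a_2=-\frac1h(2X_0+\sqrt5-(x^2+y^2)\frac{X_0'}{x})$, $b_2=-\frac{2y}{h}(\frac{X_0'}{2x}+\sqrt5)$, $c_2=\frac{2y}{h}(X_0''-\frac{X_0'}{x})$. A frame field is an analytic orthonormal frame field $F^0=[\phi,X^0_\alpha,X^0_\beta,\xi]$ of $\mathbb{R}^4$ on $D$ satisfying $\phi_x=-a_1X^0_\alpha$, $\xi_x=b_1X^0_\alpha$, $(X^0_\beta)_x=c_1X^0_\alpha$, $(X^0_\alpha)_x=a_1\phi-b_1\xi-c_1X^0_\beta$, $\phi_y=-a_2X^0_\beta$, $\xi_y=b_2X^0_\beta$, $(X^0_\alpha)_y=c_2X^0_\beta$, $(X^0_\beta)_y=a_2\phi-b_2\xi-c_2X^0_\alpha$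 (it exists and is unique up to left multiplication by a constant orthogonal matrix). A curvature surface $f^0:D\to\mathbb{R}^4$ (determined by $F^0$) is an analytic map, unique up to translation, with $df^0=\frac{x^2-y^2}{xh}X^0_\alpha dx+\frac{2y}{h}X^0_\beta dy$. *)

theory Defs
  imports "HOL-Analysis.Analysis"
begin

text \<open>The value at \<open>0\<close> is the constant term of \<open>X0\<close>; with this value the
  recursion below holds for \<open>k = 0\<close> as well.\<close>

fun X0_coeff :: "nat \<Rightarrow> real" where
  "X0_coeff 0 = 5/2"
| "X0_coeff (Suc 0) = 1"
| "X0_coeff (Suc (Suc k)) =
     - (2 * real (Suc k) - 1) / (2 * (real (Suc k) + 1) * (4 * (real (Suc k))^2 + 5/4))
       * X0_coeff (Suc k)"

lemma X0_coeff_rec: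
  assumes "k \<ge> 1"
  shows "2 * (real k + 1) * (4 * (real k)^2 + 5/4) * X0_coeff (k + 1)
           + (2 * real k - 1) * X0_coeff k = 0"
proof -
  obtain j where j: "k = Suc j" using assms by (cases k) auto
  define d where "d = 2 * (real k + 1) * (4 * (real k)^2 + 5/4)"
  have "4 * (real k)^2 + 5/4 > 0"
    by (intro add_nonneg_pos) auto
  then have "d \<noteq> 0" unfolding d_def by (simp add: add_eq_0_iff)
  moreover have "X0_coeff (k + 1) = - (2 * real k - 1) / d * X0_coeff k"
    by (simp add: j d_def)
  ultimately have "d * X0_coeff (k + 1) = - (2 * real k - 1) * X0_coeff k"
    by simp
  then show ?thesis unfolding d_def[symmetric] by (simp only: minus_mult_left[symmetric] add.left_inverse)
qed

definition X0 :: "real \<Rightarrow> real" where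
  "X0 x = 5/2 + (\<Sum>k. X0_coeff (Suc k) * x ^ (2 * Suc k))"

abbreviation X0' :: "real \<Rightarrow> real" where "X0' \<equiv> deriv X0"
abbreviation X0'' :: "real \<Rightarrow> real" where "X0'' \<equiv> deriv (deriv X0)"

definition D :: "(real \<times> real) set" where
  "D = {(x, y). x > 0}"

definition h :: "real \<Rightarrow> real \<Rightarrow> real" where
  "h x y = 2 * X0 x - x * X0' x + y^2 * (X0' x / x) + sqrt 5"

definition a1 :: "real \<Rightarrow> real \<Rightarrow> real" where
  "a1 x y = 2 * y / (x * h x y) * (X0 x + sqrt 5 / 2)"

definition b1 :: "real \<Rightarrow> real \<Rightarrow> real" where
  "b1 x y = - (1 / (x * h x y)) * (X0 x + sqrt 5 / 2 + sqrt 5 * (x^2 - y^2))"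

definition c1 :: "real \<Rightarrow> real \<Rightarrow> real" where
  "c1 x y = - (2 / (x * h x y)) * (X0 x + sqrt 5 / 2)"

definition a2 :: "real \<Rightarrow> real \<Rightarrow> real" where
  "a2 x y = - (1 / h x y) * (2 * X0 x + sqrt 5 - (x^2 + y^2) * (X0' x / x))"

definition b2 :: "real \<Rightarrow> real \<Rightarrow> real" where
  "b2 x y = - (2 * y / h x y) * (X0' x / (2 * x) + sqrt 5)"

definition c2 :: "real \<Rightarrow> real \<Rightarrow> real" where
  "c2 x y = 2 * y / h x y * (X0'' x - X0' x / x)"

text \<open>Real analyticity in two variables: near each point of \<open>S\<close> the map is the
  sum of an (unconditionally convergent) double power series centred there.\<close>

definition real_analytic_on2 ::
    "(real \<times> real \<Rightarrow> 'a::real_normed_vector) \<Rightarrow> (real \<times> real) set \<Rightarrow> bool" where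
  "real_analytic_on2 f S \<longleftrightarrow>
     (\<forall>(x0, y0)\<in>S. \<exists>r>0. \<exists>c :: nat \<times> nat \<Rightarrow> 'a. \<forall>x y. \<bar>x - x0\<bar> < r \<and> \<bar>y - y0\<bar> < r \<longrightarrow>
        ((\<lambda>(m, n). ((x - x0)^m * (y - y0)^n) *\<^sub>R c (m, n)) has_sum f (x, y)) UNIV)"

definition orthonormal_frame :: "'a::real_inner list \<Rightarrow> bool" where
  "orthonormal_frame vs \<longleftrightarrow>
     (\<forall>i<length vs. \<forall>j<length vs. vs ! i \<bullet> vs ! j = (if i = j then 1 else 0))"

definition has_partial_x ::
    "(real \<times> real \<Rightarrow> 'a::real_normed_vector) \<Rightarrow> 'a \<Rightarrow> real \<Rightarrow> real \<Rightarrow> bool" where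
  "has_partial_x g v x y \<longleftrightarrow> ((\<lambda>s. g (s, y)) has_vector_derivative v) (at x)"

definition has_partial_y ::
    "(real \<times> real \<Rightarrow> 'a::real_normed_vector) \<Rightarrow> 'a \<Rightarrow> real \<Rightarrow> real \<Rightarrow> bool" where
  "has_partial_y g v x y \<longleftrightarrow> ((\<lambda>t. g (x, t)) has_vector_derivative v) (at y)"

text \<open>Maps on \<open>D\<close> are represented by total functions on the plane; only their
  restriction to the open set \<open>D\<close> is constrained.\<close>

definition frame_field ::
    "(real \<times> real \<Rightarrow> real^4) \<Rightarrow> (real \<times> real \<Rightarrow> real^4) \<Rightarrow>
     (real \<times> real \<Rightarrow> real^4) \<Rightarrow> (real \<times> real \<Rightarrow> real^4) \<Rightarrow> bool" where
  "frame_field \<phi> X\<alpha> X\<beta> \<xi> \<longleftrightarrow>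
     real_analytic_on2 \<phi> D \<and> real_analytic_on2 X\<alpha> D \<and>
     real_analytic_on2 X\<beta> D \<and> real_analytic_on2 \<xi> D \<and>
     (\<forall>p\<in>D. orthonormal_frame [\<phi> p, X\<alpha> p, X\<beta> p, \<xi> p]) \<and>
     (\<forall>(x, y)\<in>D.
        has_partial_x \<phi> (- a1 x y *\<^sub>R X\<alpha> (x, y)) x y \<and>
        has_partial_x \<xi> (b1 x y *\<^sub>R X\<alpha> (x, y)) x y \<and>
        has_partial_x X\<beta> (c1 x y *\<^sub>R X\<alpha> (x, y)) x y \<and>
        has_partial_x X\<alpha>
          (a1 x y *\<^sub>R \<phi> (x, y) - b1 x y *\<^sub>R \<xi> (x, y) - c1 x y *\<^sub>R X\<beta> (x, y)) x y \<and>
        has_partial_y \<phi> (- a2 x y *\<^sub>R X\<beta> (x, y)) x y \<and>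
        has_partial_y \<xi> (b2 x y *\<^sub>R X\<beta> (x, y)) x y \<and>
        has_partial_y X\<alpha> (c2 x y *\<^sub>R X\<beta> (x, y)) x y \<and>
        has_partial_y X\<beta>
          (a2 x y *\<^sub>R \<phi> (x, y) - b2 x y *\<^sub>R \<xi> (x, y) - c2 x y *\<^sub>R X\<alpha> (x, y)) x y)"

definition curvature_surface :: "(real \<times> real \<Rightarrow> real^4) \<Rightarrow> bool" where
  "curvature_surface f \<longleftrightarrow>
     real_analytic_on2 f D \<and>
     (\<exists>\<phi> X\<alpha> X\<beta> \<xi>. frame_field \<phi> X\<alpha> X\<beta> \<xi> \<and>
        (\<forall>(x, y)\<in>D.
           (f has_derivative
              (\<lambda>(dx, dy). ((x^2 - y^2) / (x * h x y) * dx) *\<^sub>R X\<alpha> (x, y)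
                          + (2 * y / h x y * dy) *\<^sub>R X\<beta> (x, y)))
             (at (x, y))))"

end

theory Submission
  imports Defs
begin

text \<open>Fix \<open>x\<close> and put \<open>B = X0' / x\<close>, \<open>A = 2 X0 - x\<^sup>2 B + sqrt 5\<close>, \<open>C = X0'' - B\<close>, so that
  \<open>h = A + B y\<^sup>2\<close>. The recursion is a third-order linear equation for \<open>X0\<close>, which has the
  first integral \<open>A B = (B / 2 + sqrt 5)\<^sup>2 + C\<^sup>2 + B\<^sup>2\<close>; in particular \<open>B\<close> has no zero, and
  \<open>A\<close>, \<open>B\<close> are positive. The first integral is exactly what makes
  \<open>f + (2 y / h) \<phi> + (2 / h) X\<beta> - (2 / (B h)) (C X\<alpha> - (B / 2 + sqrt 5) \<xi>)\<close>
  independent of \<open>y\<close>. As the frame is bounded and \<open>h\<close> grows quadratically, \<open>f (x, y)\<close> tends to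
  this constant vector at both ends.\<close>

section \<open>Decay of the coefficients and convergence\<close>

text \<open>The terms are arranged as the coefficients of \<open>z ^ k\<close> in
  \<open>8 z E'\<close>, \<open>5/2 G'\<close>, \<open>2 z G'\<close> and \<open>- G\<close>, ready
  for the differential equation. The constant term \<open>5/2\<close> is exactly what makes the case
  \<open>k = 0\<close> hold.\<close>

lemma X0_coeff_recurrence:
  "8 * (real k)\<^sup>2 * (real (Suc k) * X0_coeff (Suc k)) + 5/2 * (real (Suc k) * X0_coeff (Suc k))
     + 2 * (real k * X0_coeff k) - X0_coeff k = 0"
proof (cases k)
  case (Suc j)
  then show ?thesis using X0_coeff_rec[of k] by (simp add: algebra_simps del: X0_coeff.simps)
qed simp

text \<open>With \<open>m = Suc k\<close> the true ratio decays like \<open>1 / (4 m^2)\<close>; the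
  cruder bound \<open>1 / m\<close> already yields inverse factorials by induction.\<close>

lemma X0_coeff_le: "\<bar>X0_coeff (Suc (Suc k))\<bar> * real (Suc k) \<le> \<bar>X0_coeff (Suc k)\<bar>"
proof -
  define m where "m = real (Suc k)"
  define d where "d = 2 * (m + 1) * (4 * m\<^sup>2 + 5/4)"
  have m: "m \<ge> 1" by (simp add: m_def)
  have "(2 * m - 1) * m \<le> 4 * m\<^sup>2 + 5/4"
    using m by (simp add: power2_eq_square algebra_simps)
  also have "\<dots> \<le> d"
    unfolding d_def using m mult_right_mono[of 1 "2 * (m + 1)" "4 * m\<^sup>2 + 5/4"] by simp
  finally have le: "(2 * m - 1) * m \<le> d" .
  have d: "d > 0" unfolding d_def using m by (intro mult_pos_pos add_nonneg_pos) auto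
  have "X0_coeff (Suc (Suc k)) = - (2 * m - 1) / d * X0_coeff (Suc k)"
    by (simp add: m_def d_def)
  then have "\<bar>X0_coeff (Suc (Suc k))\<bar> * m = ((2 * m - 1) * m / d) * \<bar>X0_coeff (Suc k)\<bar>"
    using m d by (simp add: abs_mult)
  also have "\<dots> \<le> 1 * \<bar>X0_coeff (Suc k)\<bar>"
    using le d by (intro mult_right_mono) auto
  finally show ?thesis by (simp add: m_def)
qed

lemma abs_X0_coeff_le_inverse_fact: "\<bar>X0_coeff (Suc k)\<bar> \<le> 1 / fact k"
proof (induction k)
  case (Suc k)
  have "\<bar>X0_coeff (Suc (Suc k))\<bar> * real (Suc k) \<le> 1 / fact k"
    using X0_coeff_le[of k] Suc by linarith
  then have "\<bar>X0_coeff (Suc (Suc k))\<bar> \<le> 1 / fact k / real (Suc k)"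
    by (simp add: pos_le_divide_eq mult_ac del: X0_coeff.simps of_nat_Suc)
  then show ?case by (simp only: fact_Suc divide_divide_eq_left mult.commute)
qed simp

text \<open>Comparison with the exponential series gives convergence on the whole line, so termwise
  differentiation is available at every point.\<close>

lemma summable_X0_coeff: "summable (\<lambda>n. X0_coeff n * z ^ n)"
proof -
  have "summable (\<lambda>n. \<bar>z\<bar> * (inverse (fact n) * \<bar>z\<bar> ^ n))"
    by (intro summable_mult summable_exp)
  then have "summable (\<lambda>n. X0_coeff (Suc n) * z ^ Suc n)"
  proof (rule summable_comparison_test')
    fix n :: nat
    have "norm (X0_coeff (Suc n) * z ^ Suc n) = \<bar>X0_coeff (Suc n)\<bar> * \<bar>z\<bar> ^ Suc n"
      by (simp add: abs_mult power_abs)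
    also have "\<dots> \<le> 1 / fact n * \<bar>z\<bar> ^ Suc n"
      by (intro mult_right_mono abs_X0_coeff_le_inverse_fact) auto
    finally show "norm (X0_coeff (Suc n) * z ^ Suc n) \<le> \<bar>z\<bar> * (inverse (fact n) * \<bar>z\<bar> ^ n)"
      by (simp add: field_simps)
  qed
  then show ?thesis by (subst summable_Suc_iff[symmetric])
qed

text \<open>Everything is expressed through \<open>z = x\<^sup>2\<close>: \<open>X0 x = G (x\<^sup>2)\<close>, \<open>B = 2 G' (x\<^sup>2)\<close> and \<open>C = 4 E (x\<^sup>2)\<close>
  with \<open>E z = z G'' z\<close>.\<close>

definition G :: "real \<Rightarrow> real" where
  "G z = (\<Sum>n. X0_coeff n * z ^ n)"

definition G' :: "real \<Rightarrow> real" where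
  "G' z = (\<Sum>n. diffs X0_coeff n * z ^ n)"

definition G'' :: "real \<Rightarrow> real" where
  "G'' z = (\<Sum>n. diffs (diffs X0_coeff) n * z ^ n)"

definition E :: "real \<Rightarrow> real" where
  "E z = z * G'' z"

lemma G_0: "G 0 = 5/2" and G'_0: "G' 0 = 1"
  by (simp_all add: G_def G'_def diffs_def)

section \<open>Termwise differentiation and the differential equation\<close>

text \<open>The Euler operator \<open>z d/dz\<close> multiplies the \<open>n\<close>-th coefficient
  by \<open>n\<close>, which avoids index shifts when series are added.\<close>

lemma sums_times_diffs:
  fixes c :: "nat \<Rightarrow> real"
  assumes "\<And>z. summable (\<lambda>n. c n * z ^ n)"
  shows "(\<lambda>n. real n * c n * z ^ n) sums (z * (\<Sum>n. diffs c n * z ^ n))"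
proof -
  have "summable (\<lambda>n. diffs c n * z ^ n)"
    by (rule termdiff_converges_all) (rule assms)
  then have "(\<lambda>n. z * (of_nat n * c n * z ^ (n - Suc 0))) sums (z * (\<Sum>n. diffs c n * z ^ n))"
    by (intro sums_mult diffs_equiv)
  moreover have "z * (of_nat n * c n * z ^ (n - Suc 0)) = real n * c n * z ^ n" for n
    by (cases n) auto
  ultimately show ?thesis by simp
qed

lemma summable_diffs_X0_coeff: "summable (\<lambda>n. diffs X0_coeff n * z ^ n)"
  by (rule termdiff_converges_all) (rule summable_X0_coeff)

lemma E_sums: "(\<lambda>n. real n * diffs X0_coeff n * z ^ n) sums E z"
  unfolding E_def G''_def by (rule sums_times_diffs) (rule summable_diffs_X0_coeff)

lemma G_has_derivative: "(G has_field_derivative G' z) (at z)"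
  unfolding G_def G'_def
  by (rule termdiffs_strong_converges_everywhere) (rule summable_X0_coeff)

lemma G'_has_derivative: "(G' has_field_derivative G'' z) (at z)"
  unfolding G'_def G''_def
  by (rule termdiffs_strong_converges_everywhere) (rule summable_diffs_X0_coeff)

text \<open>The coefficient recurrence, summed against \<open>z ^ n\<close>. In terms of
  \<open>E\<close> the third-order equation for \<open>G\<close> needs no third derivative of
  \<open>G\<close>.\<close>

lemma E_differential_equation:
  obtains E' where "(E has_field_derivative E') (at z)"
    "8 * (z * E') + 5/2 * G' z + 2 * (z * G' z) - G z = 0"
proof
  \<comment> \<open>These are the coefficients \<open>n (n + 1) X0_coeff (n + 1)\<close> of
    \<open>E\<close>; one more Euler operator supplies the factor \<open>n^2\<close> of the
    recurrence.\<close>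
  define e where "e n = real n * diffs X0_coeff n" for n
  define E' where "E' = (\<Sum>n. diffs e n * z ^ n)"
  have e: "summable (\<lambda>n. e n * z ^ n)" for z
    using E_sums[of z] by (auto simp: e_def sums_iff)
  have E_eq: "E = (\<lambda>z. \<Sum>n. e n * z ^ n)"
    using E_sums by (auto simp: e_def sums_iff)
  show "(E has_field_derivative E') (at z)"
    unfolding E_eq E'_def by (rule termdiffs_strong_converges_everywhere) (rule e)
  have "(\<lambda>n. real n * e n * z ^ n) sums (z * E')"
    unfolding E'_def by (rule sums_times_diffs) (rule e)
  moreover have "(\<lambda>n. diffs X0_coeff n * z ^ n) sums G' z"
    unfolding G'_def by (rule summable_sums) (rule summable_diffs_X0_coeff)
  moreover have "(\<lambda>n. real n * X0_coeff n * z ^ n) sums (z * G' z)"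
    unfolding G'_def by (rule sums_times_diffs) (rule summable_X0_coeff)
  moreover have "(\<lambda>n. X0_coeff n * z ^ n) sums G z"
    unfolding G_def by (rule summable_sums) (rule summable_X0_coeff)
  ultimately have
    "(\<lambda>n. 8 * (real n * e n * z ^ n) + 5/2 * (diffs X0_coeff n * z ^ n)
        + 2 * (real n * X0_coeff n * z ^ n) - X0_coeff n * z ^ n)
     sums (8 * (z * E') + 5/2 * G' z + 2 * (z * G' z) - G z)"
    by (intro sums_add sums_diff sums_mult)
  moreover have "8 * (real n * e n * z ^ n) + 5/2 * (diffs X0_coeff n * z ^ n)
        + 2 * (real n * X0_coeff n * z ^ n) - X0_coeff n * z ^ n = 0" (is "?t = 0") for n
  proof -
    have "?t = z ^ n * (8 * (real n)\<^sup>2 * (real (Suc n) * X0_coeff (Suc n))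
        + 5/2 * (real (Suc n) * X0_coeff (Suc n)) + 2 * (real n * X0_coeff n) - X0_coeff n)"
      by (simp add: e_def diffs_def power2_eq_square algebra_simps)
    then show ?thesis using X0_coeff_recurrence[of n] by simp
  qed
  ultimately have "(\<lambda>n. 0) sums (8 * (z * E') + 5/2 * G' z + 2 * (z * G' z) - G z)"
    by (simp only:)
  then show "8 * (z * E') + 5/2 * G' z + 2 * (z * G' z) - G z = 0"
    using sums_zero by (rule sums_unique2)
qed

section \<open>The first integral and positivity\<close>

text \<open>The difference \<open>I\<close> of the two sides has derivative \<open>-4 G''\<close>
  times the left side of the differential equation, so it is constant; its value is read off at
  \<open>0\<close>.\<close>

lemma first_integral:
  "(2 * G z - 2 * z * G' z + sqrt 5) * (2 * G' z)
     = (G' z + sqrt 5)\<^sup>2 + (4 * E z)\<^sup>2 + (2 * G' z)\<^sup>2"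
proof -
  define I where "I z = (2 * G z - 2 * z * G' z + sqrt 5) * (2 * G' z)
     - (G' z + sqrt 5)\<^sup>2 - (4 * E z)\<^sup>2 - (2 * G' z)\<^sup>2" for z
  have "(I has_field_derivative 0) (at z)" for z
  proof -
    obtain E' where E': "(E has_field_derivative E') (at z)"
      and ode: "8 * (z * E') + 5/2 * G' z + 2 * (z * G' z) - G z = 0"
      by (rule E_differential_equation)
    \<comment> \<open>The factor \<open>z\<close> inside \<open>E\<close> turns \<open>E'\<close>
      into the term \<open>z * E'\<close> of the equation, without any division by
      \<open>z\<close>.\<close>
    have "32 * (E z * E') = 4 * G'' z * (8 * (z * E'))"
      by (simp add: E_def)
    also have "8 * (z * E') = G z - 2 * (z * G' z) - 5/2 * G' z"
      using ode by simp
    finally have EE': "32 * (E z * E') = 4 * G'' z * (G z - 2 * (z * G' z) - 5/2 * G' z)" .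
    show ?thesis
      unfolding I_def
      apply (rule derivative_eq_intros G_has_derivative G'_has_derivative E' refl)+
      using EE' by (simp add: power2_eq_square algebra_simps)
  qed
  then have "I z = I 0" by (intro DERIV_isconst_all) auto
  also have "\<dots> = 0"
    \<comment> \<open>Here \<open>E 0 = 0\<close>, and the identity reads
      \<open>2 (5 + sqrt 5) = (1 + sqrt 5)^2 + 4\<close>.\<close>
    by (simp add: I_def E_def G_0 G'_0 power2_eq_square algebra_simps)
  finally show ?thesis by (simp add: I_def)
qed

text \<open>A nonpositive value would force a zero of \<open>G'\<close>, since
  \<open>G' 0 = 1\<close>. At a zero the left side of the first integral vanishes while the right
  side is at least \<open>5\<close>.\<close>

lemma G'_pos: "G' z > 0"
proof (rule ccontr)
  assume "\<not> G' z > 0"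
  have "connected (range G')"
    by (intro connected_continuous_image connected_UNIV continuous_at_imp_continuous_on ballI
        DERIV_isCont[OF G'_has_derivative])
  then have "0 \<in> range G'"
    by (rule connectedD_interval[OF _ rangeI[of G' z] rangeI[of G' 0]])
      (use \<open>\<not> G' z > 0\<close> in \<open>simp_all add: G'_0\<close>)
  then obtain w where "G' w = 0" by auto
  with first_integral[of w] have "0 = (sqrt 5)\<^sup>2 + (4 * E w)\<^sup>2"
    by (simp only: mult_zero_right add_0_left power_zero_numeral add_0_right)
  also have "\<dots> > 0"
    by (intro add_pos_nonneg) simp_all
  finally show False by simp
qed

section \<open>Return from \<open>z\<close> to \<open>x\<close>\<close>

lemma X0_eq: "X0 x = G (x\<^sup>2)"
proof -
  have "G (x\<^sup>2) = X0_coeff 0 + (\<Sum>n. X0_coeff (Suc n) * (x\<^sup>2) ^ Suc n)"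
    unfolding G_def using suminf_split_head[OF summable_X0_coeff[of "x\<^sup>2"]] by simp
  then show ?thesis by (simp only: X0_def X0_coeff.simps(1) power_mult)
qed

lemma X0'_eq: "X0' x = 2 * x * G' (x\<^sup>2)"
proof -
  have "((\<lambda>x. G (x\<^sup>2)) has_field_derivative G' (x\<^sup>2) * (2 * x)) (at x)"
    by (rule DERIV_chain2[OF G_has_derivative]) (auto intro!: derivative_eq_intros)
  then show ?thesis by (simp add: X0_eq[abs_def] DERIV_imp_deriv)
qed

lemma X0''_eq: "X0'' x = 2 * G' (x\<^sup>2) + 4 * E (x\<^sup>2)"
proof -
  have "((\<lambda>x. G' (x\<^sup>2)) has_field_derivative G'' (x\<^sup>2) * (2 * x)) (at x)"
    by (rule DERIV_chain2[OF G'_has_derivative]) (auto intro!: derivative_eq_intros)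
  then have "((\<lambda>x. 2 * x * G' (x\<^sup>2)) has_field_derivative
      2 * G' (x\<^sup>2) + 2 * x * (G'' (x\<^sup>2) * (2 * x))) (at x)"
    by (auto intro!: derivative_eq_intros)
  then show ?thesis
    by (simp add: X0'_eq[abs_def] DERIV_imp_deriv E_def power2_eq_square)
qed

section \<open>The vector that is constant in \<open>y\<close>\<close>

text \<open>After the product rule, the coefficients of \<phi>, \<xi> and \<open>X\<alpha>\<close>
  cancel by the choice of multipliers alone; the coefficient of \<open>X\<beta>\<close> vanishes
  because of the relation for \<open>A * B\<close>.\<close>

lemma invariant_vector_derivative_zero:
  fixes f \<phi> X\<alpha> X\<beta> \<xi> :: "real \<Rightarrow> 'v::real_normed_vector"
    and A B C p h y :: real
  assumes h: "h = A + B * y\<^sup>2" "h \<noteq> 0" and B: "B \<noteq> 0"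
    and AB: "A * B = p\<^sup>2 + C\<^sup>2 + B\<^sup>2"
    and f: "(f has_vector_derivative (2 * y / h) *\<^sub>R X\<beta> y) (at y)"
    and \<phi>: "(\<phi> has_vector_derivative ((A - B * y\<^sup>2) / h) *\<^sub>R X\<beta> y) (at y)"
    and \<xi>: "(\<xi> has_vector_derivative (- (2 * y * p / h)) *\<^sub>R X\<beta> y) (at y)"
    and X\<alpha>: "(X\<alpha> has_vector_derivative (2 * y * C / h) *\<^sub>R X\<beta> y) (at y)"
    and X\<beta>: "(X\<beta> has_vector_derivative
      ((B * y\<^sup>2 - A) / h) *\<^sub>R \<phi> y + (2 * y * p / h) *\<^sub>R \<xi> y - (2 * y * C / h) *\<^sub>R X\<alpha> y) (at y)"
  shows "((\<lambda>y. f y + (2 * y / (A + B * y\<^sup>2)) *\<^sub>R \<phi> y + (2 / (A + B * y\<^sup>2)) *\<^sub>R X\<beta> y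
      + (2 * p / (B * (A + B * y\<^sup>2))) *\<^sub>R \<xi> y - (2 * C / (B * (A + B * y\<^sup>2))) *\<^sub>R X\<alpha> y)
    has_vector_derivative 0) (at y)"
proof -
  have d\<phi>: "((\<lambda>y. 2 * y / (A + B * y\<^sup>2)) has_field_derivative 2 * (A - B * y\<^sup>2) / h\<^sup>2) (at y)"
    using h by (auto intro!: derivative_eq_intros simp: power2_eq_square field_simps)
  have d: "((\<lambda>y. k / (A + B * y\<^sup>2)) has_field_derivative - (2 * k * B * y) / h\<^sup>2) (at y)" for k
    using h by (auto intro!: derivative_eq_intros simp: power2_eq_square field_simps)
  \<comment> \<open>With \<open>1 / B\<close> moved into the numerator, the single derivative
    formula \<open>d\<close> serves the last three multipliers.\<close>
  have split: "k / (B * (A + B * y\<^sup>2)) = (k / B) / (A + B * y\<^sup>2)" for k y by simp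
  \<comment> \<open>The left side has the exact shape that the product rule produces;
    \<open>t\<close>, \<open>u\<close>, \<open>v\<close>, \<open>w\<close> stand for
    \<open>X\<beta>\<close>, \<phi>, \<xi>, \<open>X\<alpha>\<close>.\<close>
  have collect: "a *\<^sub>R t + (b *\<^sub>R (c *\<^sub>R t) + d *\<^sub>R u) + (e *\<^sub>R (g *\<^sub>R u + i *\<^sub>R v - j *\<^sub>R w) + k *\<^sub>R t)
      + (l *\<^sub>R (m *\<^sub>R t) + n *\<^sub>R v) - (q *\<^sub>R (r *\<^sub>R t) + s *\<^sub>R w)
      = (a + b * c + k + l * m - q * r) *\<^sub>R t + (d + e * g) *\<^sub>R u + (e * i + n) *\<^sub>R v - (e * j + s) *\<^sub>R w"
    for a b c d e g i j k l m n q r s :: real and t u v w :: 'v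
    by (simp add: algebra_simps)
  have "2 * y / h + 2 * y / h * ((A - B * y\<^sup>2) / h) + - (2 * 2 * B * y) / h\<^sup>2
        + 2 * p / B / h * (- (2 * y * p / h)) - 2 * C / B / h * (2 * y * C / h)
      = (2 * y * h * B + 2 * y * (A - B * y\<^sup>2) * B - 4 * B\<^sup>2 * y - 4 * y * (p\<^sup>2 + C\<^sup>2)) / (B * h\<^sup>2)"
    using h(2) B by (simp add: power2_eq_square field_simps)
  \<comment> \<open>The two terms in \<open>h\<close> and \<open>A - B * y\<^sup>2\<close> add up to
    \<open>4 * y * A * B\<close>, which brings in the product governed by the first
    integral.\<close>
  also have "\<dots> = 4 * y * (A * B - B\<^sup>2 - p\<^sup>2 - C\<^sup>2) / (B * h\<^sup>2)"
    unfolding h(1) by (simp add: power2_eq_square algebra_simps)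
  also have "\<dots> = 0" using AB by simp
  finally have cX\<beta>: "2 * y / h + 2 * y / h * ((A - B * y\<^sup>2) / h) + - (2 * 2 * B * y) / h\<^sup>2
        + 2 * p / B / h * (- (2 * y * p / h)) - 2 * C / B / h * (2 * y * C / h) = 0" .
  have c\<phi>: "2 * (A - B * y\<^sup>2) / h\<^sup>2 + 2 / h * ((B * y\<^sup>2 - A) / h) = 0"
    using h(2) by (simp add: power2_eq_square field_simps)
  have c\<xi>: "2 / h * (2 * y * p / h) + - (2 * (2 * p / B) * B * y) / h\<^sup>2 = 0"
    using h(2) B by (simp add: power2_eq_square field_simps)
  have cX\<alpha>: "2 / h * (2 * y * C / h) + - (2 * (2 * C / B) * B * y) / h\<^sup>2 = 0"
    using h(2) B by (simp add: power2_eq_square field_simps)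
  let ?d = "(2 * y / h) *\<^sub>R X\<beta> y
      + ((2 * y / h) *\<^sub>R (((A - B * y\<^sup>2) / h) *\<^sub>R X\<beta> y) + (2 * (A - B * y\<^sup>2) / h\<^sup>2) *\<^sub>R \<phi> y)
      + ((2 / h) *\<^sub>R (((B * y\<^sup>2 - A) / h) *\<^sub>R \<phi> y + (2 * y * p / h) *\<^sub>R \<xi> y - (2 * y * C / h) *\<^sub>R X\<alpha> y)
         + (- (2 * 2 * B * y) / h\<^sup>2) *\<^sub>R X\<beta> y)
      + ((2 * p / B / h) *\<^sub>R ((- (2 * y * p / h)) *\<^sub>R X\<beta> y)
         + (- (2 * (2 * p / B) * B * y) / h\<^sup>2) *\<^sub>R \<xi> y)
      - ((2 * C / B / h) *\<^sub>R ((2 * y * C / h) *\<^sub>R X\<beta> y)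
         + (- (2 * (2 * C / B) * B * y) / h\<^sup>2) *\<^sub>R X\<alpha> y)"
  have zero: "?d = 0"
    unfolding collect cX\<beta> c\<phi> c\<xi> cX\<alpha> by simp
  show ?thesis
    \<comment> \<open>The derivative \<open>0\<close> is written as \<open>?d\<close>, so that the
      differentiation rules match it syntactically.\<close>
    unfolding split zero[symmetric]
    unfolding h(1)
    by (intro has_vector_derivative_add has_vector_derivative_diff has_vector_derivative_scaleR
        d\<phi>[unfolded h(1)] d[unfolded h(1)] f[unfolded h(1)] \<phi>[unfolded h(1)] \<xi>[unfolded h(1)]
        X\<alpha>[unfolded h(1)] X\<beta>[unfolded h(1)])
qed

section \<open>Limits at both ends\<close>

lemma quadratic_quotients_tendsto_zero:
  fixes A B :: real
  assumes "A > 0" "B > 0"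
  shows "((\<lambda>y. 2 * y / (A + B * y\<^sup>2)) \<longlongrightarrow> 0) at_infinity"
    and "((\<lambda>y. k / (A + B * y\<^sup>2)) \<longlongrightarrow> 0) at_infinity"
proof -
  have le: "\<bar>c / (A + B * y\<^sup>2)\<bar> \<le> \<bar>c\<bar> / (B * y\<^sup>2)" if "y \<noteq> 0" for c y
    using assms that by (simp add: abs_divide) (intro divide_left_mono mult_pos_pos add_pos_pos; simp)
  have inv: "(inverse \<longlongrightarrow> (0::real)) at_infinity"
    by (rule tendsto_inverse_0)
  have nz: "eventually (\<lambda>y::real. y \<noteq> 0) at_infinity"
    by (auto simp: eventually_at_infinity intro!: exI[of _ 1])
  show "((\<lambda>y. 2 * y / (A + B * y\<^sup>2)) \<longlongrightarrow> 0) at_infinity"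
  proof (rule Lim_null_comparison)
    show "eventually (\<lambda>y. norm (2 * y / (A + B * y\<^sup>2)) \<le> 2 / B * \<bar>inverse y\<bar>) at_infinity"
      using nz
    proof eventually_elim
      case (elim y)
      have "\<bar>2 * y\<bar> / (B * y\<^sup>2) = 2 / B * \<bar>inverse y\<bar>"
        using elim assms by (simp add: power2_eq_square field_simps abs_if)
      with le[OF elim, of "2 * y"] show ?case by simp
    qed
    show "((\<lambda>y. 2 / B * \<bar>inverse y\<bar>) \<longlongrightarrow> 0) at_infinity"
      by (intro tendsto_mult_right_zero tendsto_rabs_zero inv)
  qed
  show "((\<lambda>y. k / (A + B * y\<^sup>2)) \<longlongrightarrow> 0) at_infinity"
  proof (rule Lim_null_comparison)
    show "eventually (\<lambda>y. norm (k / (A + B * y\<^sup>2)) \<le> \<bar>k\<bar> / B * (inverse y)\<^sup>2) at_infinity"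
      using nz
    proof eventually_elim
      case (elim y)
      have "\<bar>k\<bar> / (B * y\<^sup>2) = \<bar>k\<bar> / B * (inverse y)\<^sup>2"
        by (simp add: field_simps)
      with le[OF elim, of k] show ?case by simp
    qed
    show "((\<lambda>y. \<bar>k\<bar> / B * (inverse y)\<^sup>2) \<longlongrightarrow> 0) at_infinity"
      by (rule tendsto_mult_right_zero) (rule tendsto_null_power[OF inv], simp)
  qed
qed

lemma orthonormal_frame_norm: "orthonormal_frame vs \<Longrightarrow> v \<in> set vs \<Longrightarrow> norm v = 1"
  by (auto simp: orthonormal_frame_def in_set_conv_nth norm_eq_1)

text \<open>The filter \<open>at_infinity\<close> means that the absolute value of \<open>y\<close>
  tends to infinity, so one limit covers both ends and the two values agree.\<close>

lemma curvature_surface_tendsto_at_infinity: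
  assumes "curvature_surface f" and "x > 0"
  obtains L where "((\<lambda>y. f (x, y)) \<longlongrightarrow> L) at_infinity"
proof -
  obtain \<phi> X\<alpha> X\<beta> \<xi> where frame: "frame_field \<phi> X\<alpha> X\<beta> \<xi>"
    and df: "\<And>x y. x > 0 \<Longrightarrow> (f has_derivative
              (\<lambda>(dx, dy). ((x^2 - y^2) / (x * h x y) * dx) *\<^sub>R X\<alpha> (x, y)
                          + (2 * y / h x y * dy) *\<^sub>R X\<beta> (x, y))) (at (x, y))"
    using assms(1) by (auto simp: curvature_surface_def D_def)
  define B where "B = 2 * G' (x\<^sup>2)"
  define A where "A = 2 * G (x\<^sup>2) - 2 * x\<^sup>2 * G' (x\<^sup>2) + sqrt 5"
  define C where "C = 4 * E (x\<^sup>2)"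
  define p where "p = G' (x\<^sup>2) + sqrt 5"
  have X0': "X0' x / x = B" and X0'': "X0'' x - X0' x / x = C"
    using \<open>x > 0\<close> by (simp_all add: X0'_eq X0''_eq B_def C_def)
  have AB: "A * B = p\<^sup>2 + C\<^sup>2 + B\<^sup>2"
    using first_integral[of "x\<^sup>2"] by (simp add: A_def B_def C_def p_def)
  have B: "B > 0" by (simp add: B_def G'_pos)
  \<comment> \<open>The first integral bounds \<open>A * B\<close> below by
    \<open>B\<^sup>2\<close>, which transfers the sign of \<open>B\<close> to
    \<open>A\<close>.\<close>
  have "A * B > 0"
    unfolding AB using B by (intro add_nonneg_pos) auto
  with B have A: "A > 0" by (simp add: zero_less_mult_iff)
  have h: "h x y = A + B * y\<^sup>2" for y
    unfolding h_def X0' by (simp add: X0'_eq X0_eq A_def power2_eq_square algebra_simps)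
  have h_pos: "A + B * y\<^sup>2 > 0" for y
    using A B by (intro add_pos_nonneg) auto
  have "a2 x y = - (1 / h x y) * (A - B * y\<^sup>2)" for y
    unfolding a2_def X0' by (simp add: X0_eq A_def B_def algebra_simps)
  then have a2: "a2 x y = (B * y\<^sup>2 - A) / (A + B * y\<^sup>2)" for y
    by (simp add: h diff_divide_distrib)
  have "X0' x / (2 * x) + sqrt 5 = p"
    using X0' by (simp add: p_def B_def field_simps)
  then have b2: "b2 x y = - (2 * y * p / (A + B * y\<^sup>2))" for y
    by (simp add: b2_def h)
  have c2: "c2 x y = 2 * y * C / (A + B * y\<^sup>2)" for y
    unfolding c2_def X0'' by (simp add: h)
  define g where "g y = f (x, y) + (2 * y / (A + B * y\<^sup>2)) *\<^sub>R \<phi> (x, y) + (2 / (A + B * y\<^sup>2)) *\<^sub>R X\<beta> (x, y)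
      + (2 * p / (B * (A + B * y\<^sup>2))) *\<^sub>R \<xi> (x, y) - (2 * C / (B * (A + B * y\<^sup>2))) *\<^sub>R X\<alpha> (x, y)" for y
  have "(g has_vector_derivative 0) (at y)" for y
    unfolding g_def
  proof (rule invariant_vector_derivative_zero[OF refl])
    have "((\<lambda>t. f (x, t)) has_derivative (\<lambda>t. (2 * y / h x y * t) *\<^sub>R X\<beta> (x, y))) (at y)"
    proof -
      \<comment> \<open>Restriction to the vertical line through \<open>x\<close> kills the
        \<open>dx\<close> component of the differential.\<close>
      have "(Pair x has_derivative Pair 0) (at y)"
        by (rule has_derivative_Pair[OF has_derivative_const has_derivative_ident])
      from has_derivative_compose[OF this df[OF \<open>x > 0\<close>]] show ?thesis by simp
    qed
    then show "((\<lambda>t. f (x, t)) has_vector_derivative (2 * y / (A + B * y\<^sup>2)) *\<^sub>R X\<beta> (x, y)) (at y)"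
      by (simp add: has_vector_derivative_def h mult.commute)
    have partials: "((\<lambda>t. \<phi> (x, t)) has_vector_derivative - a2 x y *\<^sub>R X\<beta> (x, y)) (at y)"
      "((\<lambda>t. \<xi> (x, t)) has_vector_derivative b2 x y *\<^sub>R X\<beta> (x, y)) (at y)"
      "((\<lambda>t. X\<alpha> (x, t)) has_vector_derivative c2 x y *\<^sub>R X\<beta> (x, y)) (at y)"
      "((\<lambda>t. X\<beta> (x, t)) has_vector_derivative
          a2 x y *\<^sub>R \<phi> (x, y) - b2 x y *\<^sub>R \<xi> (x, y) - c2 x y *\<^sub>R X\<alpha> (x, y)) (at y)"
      using frame \<open>x > 0\<close> by (simp_all add: frame_field_def D_def has_partial_y_def)
    have "- a2 x y = (A - B * y\<^sup>2) / (A + B * y\<^sup>2)"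
      by (simp add: a2 diff_divide_distrib)
    with partials show
      "((\<lambda>t. \<phi> (x, t)) has_vector_derivative ((A - B * y\<^sup>2) / (A + B * y\<^sup>2)) *\<^sub>R X\<beta> (x, y)) (at y)"
      "((\<lambda>t. \<xi> (x, t)) has_vector_derivative (- (2 * y * p / (A + B * y\<^sup>2))) *\<^sub>R X\<beta> (x, y)) (at y)"
      "((\<lambda>t. X\<alpha> (x, t)) has_vector_derivative (2 * y * C / (A + B * y\<^sup>2)) *\<^sub>R X\<beta> (x, y)) (at y)"
      "((\<lambda>t. X\<beta> (x, t)) has_vector_derivative
        ((B * y\<^sup>2 - A) / (A + B * y\<^sup>2)) *\<^sub>R \<phi> (x, y) + (2 * y * p / (A + B * y\<^sup>2)) *\<^sub>R \<xi> (x, y)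
          - (2 * y * C / (A + B * y\<^sup>2)) *\<^sub>R X\<alpha> (x, y)) (at y)"
      by (simp_all only: a2 b2 c2) simp
    show "A + B * y\<^sup>2 \<noteq> 0" using h_pos[of y] by simp
    show "B \<noteq> 0" using B by simp
  qed (rule AB)
  then obtain L where L: "g y = L" for y
    using has_vector_derivative_zero_constant[of UNIV g] by auto
  have orth: "orthonormal_frame [\<phi> (x, y), X\<alpha> (x, y), X\<beta> (x, y), \<xi> (x, y)]" for y
    using frame \<open>x > 0\<close> by (simp add: frame_field_def D_def)
  have norms: "norm (\<phi> (x, y)) = 1" "norm (X\<alpha> (x, y)) = 1"
      "norm (X\<beta> (x, y)) = 1" "norm (\<xi> (x, y)) = 1" for y
    by (simp_all add: orthonormal_frame_norm[OF orth[of y]])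
  \<comment> \<open>The frame vectors have norm 1, so every correction term tends to zero with its
    scalar multiplier.\<close>
  have null: "((\<lambda>y. s y *\<^sub>R v y) \<longlongrightarrow> 0) F"
    if "(s \<longlongrightarrow> 0) F" "\<And>y. norm (v y) = 1" for s and v :: "real \<Rightarrow> real^4" and F
    using that by (intro lim_null_scaleR_bounded[where B = 1]) auto
  have f_eq: "f (x, y) = L - (2 * y / (A + B * y\<^sup>2)) *\<^sub>R \<phi> (x, y) - (2 / (A + B * y\<^sup>2)) *\<^sub>R X\<beta> (x, y)
      - (2 * p / (B * (A + B * y\<^sup>2))) *\<^sub>R \<xi> (x, y) + (2 * C / (B * (A + B * y\<^sup>2))) *\<^sub>R X\<alpha> (x, y)" for y
    unfolding L[of y, symmetric] g_def by simp
  have "((\<lambda>y. k / (B * (A + B * y\<^sup>2))) \<longlongrightarrow> 0) at_infinity" for k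
    using quadratic_quotients_tendsto_zero(2)[OF A B, of "k / B"] by simp
  then have "((\<lambda>y. f (x, y)) \<longlongrightarrow> L - 0 - 0 - 0 + 0) at_infinity"
    unfolding f_eq
    by (intro tendsto_add tendsto_diff tendsto_const null norms
        quadratic_quotients_tendsto_zero[OF A B])
  with that show thesis by simp
qed

theorem corollary4p10:
  fixes f :: "real \<times> real \<Rightarrow> real^4" and x :: real
  assumes "curvature_surface f" and "x > 0"
  shows "\<exists>L. ((\<lambda>y. f (x, y)) \<longlongrightarrow> L) at_top \<and> ((\<lambda>y. f (x, y)) \<longlongrightarrow> L) at_bot"
proof -
  obtain L where "((\<lambda>y. f (x, y)) \<longlongrightarrow> L) at_infinity"
    using assms by (rule curvature_surface_tendsto_at_infinity)
  then show ?thesis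
    by (meson tendsto_mono at_top_le_at_infinity at_bot_le_at_infinity)
qed

end
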